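(* For all integers $n\ge 0$, $$F_{2n+2}^2=F_1^2+\sum_{k=1}^n\left\{F_{2k+1}^2+2\sum_{i=1}^{2k}F_i^2\right\}.$$
   Context: The Fibonacci numbers are $F_0=0$, $F_1=1$, $F_n=F_{n-1}+F_{n-2}$ for $n\ge2$. Empty sums are $0$. *)

theory Defs
  imports "HOL-Number_Theory.Fib"
begin

end

theory Submission
  imports Defs
begin

text \<open>By \<open>sum_fib_squares\<close>, the k-th summand is F_{2k+1}^2 + 2 F_{2k} F_{2k+1} =
  (F_{2k+1} + F_{2k})^2 - F_{2k}^2 = F_{2k+2}^2 - F_{2k}^2, so the sum telescopes down to F_2^2 =
  F_1^2.\<close>

lemma sum_fib_squares: "(\<Sum>i = 1..m. (fib i)\<^sup>2) = fib m * fib (m + 1)"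
  by (induction m) (simp_all add: power2_eq_square algebra_simps)

theorem mainTheorem4:
  fixes n :: nat
  shows "(fib (2 * n + 2))\<^sup>2 =
    (fib 1)\<^sup>2 + (\<Sum>k = 1..n. (fib (2 * k + 1))\<^sup>2 + 2 * (\<Sum>i = 1..2 * k. (fib i)\<^sup>2))"
  unfolding sum_fib_squares
proof (induction n)
  case 0
  show ?case by simp
next
  case (Suc n)
  have "fib (2 * Suc n + 2) = fib (2 * Suc n + 1) + fib (2 * n + 2)"
    by simp
  \<comment> \<open>The square keeps the index \<open>2 * n + 2\<close> to match
    \<open>Suc.IH\<close>; the cross term writes the same index as \<open>2 * Suc n\<close> to match
    the new summand.\<close>
  then have "(fib (2 * Suc n + 2))\<^sup>2 = (fib (2 * n + 2))\<^sup>2 +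
      ((fib (2 * Suc n + 1))\<^sup>2 + 2 * (fib (2 * Suc n) * fib (2 * Suc n + 1)))"
    by (simp only: power2_sum) simp
  then show ?case
    by (simp only: Suc.IH sum.cl_ivl_Suc) simp
qed

end
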